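(* Consider the formulae \begin{align*} a&=q_1q_2(r_1s_2+r_2s_1)(r_1s_1-r_2s_2)(p_1^2+p_2^2),\\ b&=p_1p_2(r_1s_2+r_2s_1)(r_1s_1-r_2s_2)(q_1^2+q_2^2),\\ c&=r_1r_2(p_1q_2+p_2q_1)(p_1q_1-p_2q_2)(s_1^2+s_2^2),\\ d&=s_1s_2(p_1q_2+p_2q_1)(p_1q_1-p_2q_2)(r_1^2+r_2^2),\\ e&=(p_1q_2+p_2q_1)(p_1q_1-p_2q_2)(r_1s_2+r_2s_1)(r_1s_1-r_2s_2),\\ x_1&=q_1q_2(r_1s_2+r_2s_1)(r_1s_1-r_2s_2)(p_1-p_2)(p_1+p_2),\\ x_2&=s_1s_2(p_1q_2+p_2q_1)(p_1q_1-p_2q_2)(r_1-r_2)(r_1+r_2),\\ y_1&=2p_1p_2q_1q_2(r_1s_2+r_2s_1)(r_1s_1-r_2s_2),\\ y_2&=-2r_1r_2s_1s_2(p_1q_2+p_2q_1)(p_1q_1-p_2q_2), \end{align*} where $p_i,q_i,r_i,s_i$ ($i=1,2$) are arbitrary rational parameters. Up to scaling, these formulae generate all convex quadrilaterals whose four sides $a,b,c,d$, one diagonal $e$ and the area are given by rational numbers, where the parameters must be chosen such that the numbers $a,b,c,d,e,f$, $-y_1y_2$, $-(y_1-y_2)(x_1y_2-x_2y_1)$ and $(y_1-y_2)(ey_1-ey_2+x_1y_2-x_2y_1)$ are all positive. The area of the quadrilateral defined by these formulae is given by \begin{align*} &(p_1q_2+p_2q_1)(p_1q_1-p_2q_2)(r_1s_2+r_2s_1)(r_1s_1-r_2s_2)\\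 &\times\bigl[p_1^2q_1q_2r_1r_2s_1s_2+\{q_1^2r_1r_2s_1s_2+(r_1s_2+r_2s_1)(r_1s_1-r_2s_2)q_1q_2-q_2^2r_1r_2s_1s_2\}p_1p_2-p_2^2q_1q_2r_1r_2s_1s_2\bigr]. \end{align*}
   Context: The quadrilateral defined by the formulae is $OABC$, with consecutive vertices $O=(0,0)$, $A=(x_1,y_1)$, $B=(e,0)$, $C=(x_2,y_2)$, so that its sides are $OA=a$, $AB=b$, $BC=c$, $OC=d$ and the diagonal $OB$ has length $e$. The number $f=\sqrt{(x_1-x_2)^2+(y_1-y_2)^2}$ is the length of the other diagonal $AC$; it is not required to be rational here.
   Formalization: The printed area expression equals e(y_1-y_2)/2, which is negative for admissible parameters with y_1<0 (e.g. p_1=q_1=r_1=s_1=2, p_2=q_2=r_2=s_2=-1); the formal statement gives the area as this expression if y_1>0 and as its negative otherwise. *)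

theory Defs
  imports "HOL-Analysis.Analysis"
begin

text \<open>
  A (strictly) convex quadrilateral with consecutive vertices \<open>P, Q, R, S\<close>: its four sides are edges
  of the convex polygon spanned by the vertices.  An edge is a face of dimension one, so every
  vertex is an extreme point and no three of the vertices are collinear; distinctness rules
  out the triangles (\<open>P = R\<close> or \<open>Q = S\<close>).  The order of the vertices matters: self-crossing orders
  are excluded.
\<close>

definition convex_quadrilateral :: "real^2 \<Rightarrow> real^2 \<Rightarrow> real^2 \<Rightarrow> real^2 \<Rightarrow> bool" where
  "convex_quadrilateral P Q R S \<longleftrightarrow>
     distinct [P, Q, R, S] \<and>
     closed_segment P Q edge_of convex hull {P, Q, R, S} \<and>
     closed_segment Q R edge_of convex hull {P, Q, R, S} \<and>
     closed_segment R S edge_of convex hull {P, Q, R, S} \<and>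
     closed_segment S P edge_of convex hull {P, Q, R, S}"

text \<open>The region enclosed by a convex quadrilateral is the convex hull of its vertices; this
  is its area only in the convex case.\<close>

definition quad_area :: "real^2 \<Rightarrow> real^2 \<Rightarrow> real^2 \<Rightarrow> real^2 \<Rightarrow> real" where
  "quad_area P Q R S = measure lebesgue (convex hull {P, Q, R, S})"

record params =
  p1 :: rat
  p2 :: rat
  q1 :: rat
  q2 :: rat
  r1 :: rat
  r2 :: rat
  s1 :: rat
  s2 :: rat

definition len_a :: "params \<Rightarrow> rat" where
  "len_a t = q1 t * q2 t * (r1 t * s2 t + r2 t * s1 t) * (r1 t * s1 t - r2 t * s2 t)
               * ((p1 t)\<^sup>2 + (p2 t)\<^sup>2)"

definition len_b :: "params \<Rightarrow> rat" where
  "len_b t = p1 t * p2 t * (r1 t * s2 t + r2 t * s1 t) * (r1 t * s1 t - r2 t * s2 t)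
               * ((q1 t)\<^sup>2 + (q2 t)\<^sup>2)"

definition len_c :: "params \<Rightarrow> rat" where
  "len_c t = r1 t * r2 t * (p1 t * q2 t + p2 t * q1 t) * (p1 t * q1 t - p2 t * q2 t)
               * ((s1 t)\<^sup>2 + (s2 t)\<^sup>2)"

definition len_d :: "params \<Rightarrow> rat" where
  "len_d t = s1 t * s2 t * (p1 t * q2 t + p2 t * q1 t) * (p1 t * q1 t - p2 t * q2 t)
               * ((r1 t)\<^sup>2 + (r2 t)\<^sup>2)"

definition len_e :: "params \<Rightarrow> rat" where
  "len_e t = (p1 t * q2 t + p2 t * q1 t) * (p1 t * q1 t - p2 t * q2 t)
               * (r1 t * s2 t + r2 t * s1 t) * (r1 t * s1 t - r2 t * s2 t)"

definition x1 :: "params \<Rightarrow> rat" where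
  "x1 t = q1 t * q2 t * (r1 t * s2 t + r2 t * s1 t) * (r1 t * s1 t - r2 t * s2 t)
            * (p1 t - p2 t) * (p1 t + p2 t)"

definition x2 :: "params \<Rightarrow> rat" where
  "x2 t = s1 t * s2 t * (p1 t * q2 t + p2 t * q1 t) * (p1 t * q1 t - p2 t * q2 t)
            * (r1 t - r2 t) * (r1 t + r2 t)"

definition y1 :: "params \<Rightarrow> rat" where
  "y1 t = 2 * p1 t * p2 t * q1 t * q2 t
            * (r1 t * s2 t + r2 t * s1 t) * (r1 t * s1 t - r2 t * s2 t)"

definition y2 :: "params \<Rightarrow> rat" where
  "y2 t = - 2 * r1 t * r2 t * s1 t * s2 t
            * (p1 t * q2 t + p2 t * q1 t) * (p1 t * q1 t - p2 t * q2 t)"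

definition len_f :: "params \<Rightarrow> real" where
  "len_f t = sqrt (of_rat ((x1 t - x2 t)\<^sup>2 + (y1 t - y2 t)\<^sup>2))"

definition vertex_O :: "params \<Rightarrow> real^2" where
  "vertex_O t = vector [0, 0]"

definition vertex_A :: "params \<Rightarrow> real^2" where
  "vertex_A t = vector [of_rat (x1 t), of_rat (y1 t)]"

definition vertex_B :: "params \<Rightarrow> real^2" where
  "vertex_B t = vector [of_rat (len_e t), 0]"

definition vertex_C :: "params \<Rightarrow> real^2" where
  "vertex_C t = vector [of_rat (x2 t), of_rat (y2 t)]"

definition admissible :: "params \<Rightarrow> bool" where
  "admissible t \<longleftrightarrow>
     0 < len_a t \<and> 0 < len_b t \<and> 0 < len_c t \<and> 0 < len_d t \<and> 0 < len_e t \<and> 0 < len_f t \<and>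
     0 < - y1 t * y2 t \<and>
     0 < - (y1 t - y2 t) * (x1 t * y2 t - x2 t * y1 t) \<and>
     0 < (y1 t - y2 t) * (len_e t * y1 t - len_e t * y2 t + x1 t * y2 t - x2 t * y1 t)"

text \<open>
  This polynomial equals \<open>len_e t * (y1 t - y2 t) / 2\<close>, i.e. it is an oriented area: positive
  when \<open>A\<close> lies above the axis \<open>OB\<close>, negative when \<open>A\<close> lies below it.  Both signs
  occur for admissible parameters (negating \<open>p2, q2, r2, s2\<close> reflects the quadrilateral in \<open>OB\<close>).
\<close>

definition area_formula :: "params \<Rightarrow> rat" where
  "area_formula t =
     (p1 t * q2 t + p2 t * q1 t) * (p1 t * q1 t - p2 t * q2 t)
     * (r1 t * s2 t + r2 t * s1 t) * (r1 t * s1 t - r2 t * s2 t)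
     * ((p1 t)\<^sup>2 * q1 t * q2 t * r1 t * r2 t * s1 t * s2 t
        + ((q1 t)\<^sup>2 * r1 t * r2 t * s1 t * s2 t
           + (r1 t * s2 t + r2 t * s1 t) * (r1 t * s1 t - r2 t * s2 t) * q1 t * q2 t
           - (q2 t)\<^sup>2 * r1 t * r2 t * s1 t * s2 t) * p1 t * p2 t
        - (p2 t)\<^sup>2 * q1 t * q2 t * r1 t * r2 t * s1 t * s2 t)"

end

theory Submission
  imports Defs
begin

text \<open>
  The diagonal \<open>OB\<close> divides the quadrilateral into two triangles with the common base \<open>e\<close>.  A
  triangle whose sides and height over the base are rational has rational half-angle cotangents
  at the ends of the base, and conversely these two numbers determine the triangle up to scaling.
  With the cotangents \<open>p1 / p2\<close>, \<open>q1 / q2\<close> for the upper and \<open>r1 / r2\<close>, \<open>s1 / s2\<close> for the lower triangle,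
  cleared of denominators and scaled to a common base, the given formulae arise.

  Given a quadrilateral with rational sides, diagonal and area, place the diagonal on the axis.  The
  law of cosines makes the abscissae of \<open>A\<close> and \<open>C\<close> rational, hence also the squares of their
  heights.  The area makes the sum of the heights rational, and since the difference of their squares
  is rational, so is each height (\<open>rational_heights\<close>).  The parameters can now be read off
  (\<open>half_angle_triangle\<close>, \<open>parameters_exist\<close>).

  The geometry is reduced to signed areas of triangles.  A quadrilateral is convex iff for each side
  the two other vertices lie strictly on one side of its line (\<open>convex_quadrilateral_iff_orient\<close>),
  and for the formulae this is the condition on signs in the definition of admissibility
  (\<open>convex_vertices_iff\<close>).  In a convex quadrilateral the diagonals cross, so that it is the union of
  the two triangles on a diagonal and its area is the sum of theirs (\<open>quad_area_orient\<close>).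
\<close>

section \<open>Orientation of triangles in the plane\<close>

text \<open>Twice the signed area of the triangle, positive when it is traversed anticlockwise.\<close>
definition orient :: "real^2 \<Rightarrow> real^2 \<Rightarrow> real^2 \<Rightarrow> real" where
  "orient P Q R = (Q$1 - P$1) * (R$2 - P$2) - (Q$2 - P$2) * (R$1 - P$1)"

lemma inner_real2: "u \<bullet> v = u$1 * v$1 + u$2 * v$2" for u v :: "real^2"
  by (simp add: inner_vec_def sum_2)

lemma orient_affine:
  assumes "u + v = 1"
  shows "orient P Q (u *\<^sub>R X + v *\<^sub>R Y) = u * orient P Q X + v * orient P Q Y"
proof -
  have u: "u = 1 - v" using assms by simp
  show ?thesis unfolding u orient_def by (simp add: algebra_simps)
qed

text \<open>Lagrange's identity for the cross product in the plane.  A single orientation changes sign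
  under reflections, but a product of two is expressed by inner products alone; this is why
  convexity is stated through such products, and how it is transported along similarities.\<close>
lemma orient_product:
  "orient P Q R * orient P' Q' R' =
     ((Q - P) \<bullet> (Q' - P')) * ((R - P) \<bullet> (R' - P'))
     - ((Q - P) \<bullet> (R' - P')) * ((R - P) \<bullet> (Q' - P'))"
  by (simp add: orient_def inner_real2 algebra_simps)

section \<open>Convex quadrilaterals and orientations\<close>

text \<open>The hypothesis that a side is an edge does not by itself exclude another vertex from its
  interior; this is excluded by the neighbouring side being a face.  A face that contains a point
  strictly between \<open>P\<close> and \<open>Q\<close> contains \<open>P\<close>, so \<open>R\<close> would lie between \<open>P\<close> and \<open>Q\<close> while \<open>P\<close>
  lies between \<open>Q\<close> and \<open>R\<close>.\<close>
lemma not_in_adjacent_face: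
  fixes P Q R :: "'a::euclidean_space"
  assumes "distinct [P, Q, R]" "P \<in> H" "Q \<in> H" "closed_segment Q R face_of H"
  shows "R \<notin> closed_segment P Q"
proof
  assume R: "R \<in> closed_segment P Q"
  then have "R \<in> open_segment P Q"
    using assms(1) by (auto simp: open_segment_def)
  then have "P \<in> closed_segment Q R"
    using assms unfolding face_of_def by (metis ends_in_segment(2))
  with R have "dist P Q = dist P R + dist R Q" "dist Q R = dist Q P + dist P R"
    by (simp_all add: between_mem_segment[symmetric] between)
  then have "dist P R = 0" by (simp add: dist_commute)
  then show False using assms(1) by simp
qed

text \<open>Faces of polytopes are exposed, so the side is cut out by a supporting line, and the two
  other vertices lie strictly on one side of it.  The normal of that line is a multiple of the
  rotated side, so its inner products have the signs of the orientations, up to a common factor.\<close>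
lemma edge_imp_same_side:
  assumes face: "closed_segment P Q face_of convex hull {P, Q, R, S}"
    and "P \<noteq> Q" "R \<notin> closed_segment P Q" "S \<notin> closed_segment P Q"
  shows "0 < orient P Q R * orient P Q S"
proof -
  have "closed_segment P Q exposed_face_of convex hull {P, Q, R, S}"
    using face by (simp add: exposed_face_of_polyhedron polyhedron_convex_hull)
  then obtain n \<beta> where le: "convex hull {P, Q, R, S} \<subseteq> {x. n \<bullet> x \<le> \<beta>}"
    and eq: "closed_segment P Q = convex hull {P, Q, R, S} \<inter> {x. n \<bullet> x = \<beta>}"
    unfolding exposed_face_of_def by blast
  have vert: "R \<in> convex hull {P, Q, R, S}" "S \<in> convex hull {P, Q, R, S}"
    by (simp_all add: hull_inc)
  have "n \<bullet> P = \<beta>" "n \<bullet> Q = \<beta>"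
    using eq ends_in_segment by blast+
  then have PQ: "n \<bullet> (Q - P) = 0"
    by (simp add: inner_diff_right)
  have "n \<bullet> R < \<beta>" "n \<bullet> S < \<beta>"
    using le eq vert assms(3,4) by (fastforce simp: less_le)+
  then have neg: "n \<bullet> (R - P) < 0" "n \<bullet> (S - P) < 0"
    using \<open>n \<bullet> P = \<beta>\<close> by (simp_all add: inner_diff_right)
  \<comment> \<open>The normal \<open>n\<close> is orthogonal to \<open>Q - P\<close>, so only one product in Lagrange's identity survives.\<close>
  have "orient P Q V * orient P Q (P + n) = (norm (Q - P))\<^sup>2 * (n \<bullet> (V - P))" for V
    using PQ by (simp add: orient_product power2_norm_eq_inner inner_commute)
  note key = this
  have "(orient P Q R * orient P Q S) * (orient P Q (P + n))\<^sup>2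
      = (orient P Q R * orient P Q (P + n)) * (orient P Q S * orient P Q (P + n))"
    by (simp add: power2_eq_square)
  also have "\<dots> = (norm (Q - P))^4 * ((n \<bullet> (R - P)) * (n \<bullet> (S - P)))"
    unfolding key by (simp add: power4_eq_xxxx power2_eq_square)
  also have "\<dots> > 0"
    using neg \<open>P \<noteq> Q\<close> by (simp add: mult_neg_neg)
  finally show ?thesis
    by (simp add: zero_less_mult_iff)
qed

text \<open>The line \<open>PQ\<close> misses the segment \<open>RS\<close>, on which the orientation keeps its sign.\<close>
lemma same_side_imp_edge:
  assumes "0 < orient P Q R * orient P Q S"
  shows "closed_segment P Q edge_of convex hull {P, Q, R, S}"
proof -
  have ne: "P \<noteq> Q" "R \<notin> {P, Q}" "S \<notin> {P, Q}"
    using assms by (auto simp: orient_def)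
  have "orient P Q x = 0" if "x \<in> affine hull {P, Q}" for x
    using that by (auto simp: affine_hull_2 orient_affine) (auto simp: orient_def)
  moreover have "orient P Q x \<noteq> 0" if x: "x \<in> convex hull {R, S}" for x
  proof -
    obtain u v where uv: "0 \<le> u" "0 \<le> v" "u + v = 1" "x = u *\<^sub>R R + v *\<^sub>R S"
      using x by (auto simp: convex_hull_2)
    have "u * (orient P Q R)\<^sup>2 + v * (orient P Q R * orient P Q S) > 0"
    proof (cases "u = 0")
      case False
      then show ?thesis
        using uv assms mult_nonneg_nonneg[OF uv(2) less_imp_le[OF assms]] ne
        by (intro add_pos_nonneg mult_pos_pos) auto
    qed (use uv assms in simp)
    then have "orient P Q R * orient P Q x > 0"
      using uv by (simp add: orient_affine power2_eq_square algebra_simps)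
    then show ?thesis by auto
  qed
  moreover have "{P, Q, R, S} - {P, Q} = {R, S}"
    using ne by auto
  ultimately have "convex hull {P, Q} face_of convex hull {P, Q, R, S}"
    by (intro face_of_convex_hulls) auto
  moreover have "aff_dim (convex hull {P, Q}) = 1"
    using \<open>P \<noteq> Q\<close> by (simp add: aff_dim_convex_hull)
  ultimately show ?thesis
    by (simp add: edge_of_def segment_convex_hull)
qed

lemma convex_quadrilateral_iff_orient:
  "convex_quadrilateral P Q R S \<longleftrightarrow>
     0 < orient P Q R * orient P Q S \<and> 0 < orient Q R S * orient Q R P \<and>
     0 < orient R S P * orient R S Q \<and> 0 < orient S P Q * orient S P R"
  (is "?L \<longleftrightarrow> ?R")
proof
  let ?H = "convex hull {P, Q, R, S}"
  have perm: "{Q, R, S, P} = {P, Q, R, S}" "{R, S, P, Q} = {P, Q, R, S}"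
    "{S, P, Q, R} = {P, Q, R, S}"
    by auto
  {
    assume ?L
    then have d: "distinct [P, Q, R, S]"
      and f: "closed_segment P Q face_of ?H" "closed_segment Q R face_of ?H"
        "closed_segment R S face_of ?H" "closed_segment S P face_of ?H"
      unfolding convex_quadrilateral_def edge_of_def by auto
    have f': "closed_segment Q P face_of ?H" "closed_segment R Q face_of ?H"
        "closed_segment S R face_of ?H" "closed_segment P S face_of ?H"
      using f by (simp_all add: closed_segment_commute)
    have v: "P \<in> ?H" "Q \<in> ?H" "R \<in> ?H" "S \<in> ?H"
      by (simp_all add: hull_inc)
    note out = not_in_adjacent_face[where H = ?H]
    have "R \<notin> closed_segment P Q" "S \<notin> closed_segment P Q"
      "S \<notin> closed_segment Q R" "P \<notin> closed_segment Q R"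
      "P \<notin> closed_segment R S" "Q \<notin> closed_segment R S"
      "Q \<notin> closed_segment S P" "R \<notin> closed_segment S P"
      using out[OF _ v(1,2) f(2)] out[OF _ v(2,1) f'(4)] out[OF _ v(2,3) f(3)]
        out[OF _ v(3,2) f'(1)] out[OF _ v(3,4) f(4)] out[OF _ v(4,3) f'(2)]
        out[OF _ v(4,1) f(1)] out[OF _ v(1,4) f'(3)] d
      by (auto simp: closed_segment_commute)
    then show ?R
      using edge_imp_same_side[of P Q R S] edge_imp_same_side[of Q R S P]
        edge_imp_same_side[of R S P Q] edge_imp_same_side[of S P Q R] f d
      by (auto simp: perm)
  }
  {
    assume R: ?R
    then have "distinct [P, Q, R, S]"
      by (auto simp: orient_def)
    with R show ?L
      using same_side_imp_edge[of P Q R S] same_side_imp_edge[of Q R S P]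
        same_side_imp_edge[of R S P Q] same_side_imp_edge[of S P Q R]
      unfolding convex_quadrilateral_def perm by blast
  }
qed

section \<open>The area of a convex quadrilateral\<close>

lemma measure_triangle:
  "measure lebesgue (convex hull {P, Q, R}) = \<bar>orient P Q R\<bar> / 2"
proof -
  have "convex hull {P, Q, R} \<in> sets borel"
    by (simp add: borel_closed compact_imp_closed finite_imp_compact_convex_hull)
  then show ?thesis
    by (simp add: content_triangle orient_def abs_minus_commute algebra_simps)
qed

text \<open>The affine dependence of four points in the plane.  When the four coefficients have one
  sign, it exhibits a common point of the two diagonals as a convex combination on each of them.\<close>
lemma diagonals_cross:
  fixes P Q R S :: "real^2"
  shows "orient Q R S *\<^sub>R P + orient P Q S *\<^sub>R R = orient P R S *\<^sub>R Q + orient P Q R *\<^sub>R S"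
    and "orient Q R S + orient P Q S = orient P R S + orient P Q R"
proof -
  show "orient Q R S + orient P Q S = orient P R S + orient P Q R"
    unfolding orient_def by algebra
  have "orient Q R S * P$1 + orient P Q S * R$1 = orient P R S * Q$1 + orient P Q R * S$1"
    "orient Q R S * P$2 + orient P Q S * R$2 = orient P R S * Q$2 + orient P Q R * S$2"
    unfolding orient_def by algebra+
  then show "orient Q R S *\<^sub>R P + orient P Q S *\<^sub>R R = orient P R S *\<^sub>R Q + orient P Q R *\<^sub>R S"
    by (simp add: vec_eq_iff forall_2)
qed

text \<open>The dependence trades weight on \<open>Q\<close> and \<open>S\<close> for weight on \<open>P\<close> and \<open>R\<close>.  The last hypothesis
  says that in this exchange the weight of \<open>S\<close> runs out no later than that of \<open>Q\<close>, so that \<open>S\<close> can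
  be removed without making the weight of \<open>Q\<close> negative.\<close>
lemma eliminate_vertex:
  fixes P Q R S :: "'a::real_vector"
  assumes cross: "\<alpha> *\<^sub>R P + \<rho> *\<^sub>R R = \<mu> *\<^sub>R Q + \<nu> *\<^sub>R S" "\<alpha> + \<rho> = \<mu> + \<nu>"
    and pos: "0 \<le> \<alpha>" "0 \<le> \<rho>" "0 < \<nu>"
    and coeff: "0 \<le> p" "0 \<le> r" "0 \<le> s" "p + q + r + s = 1" "s * \<mu> \<le> q * \<nu>"
  shows "p *\<^sub>R P + q *\<^sub>R Q + r *\<^sub>R R + s *\<^sub>R S \<in> convex hull {P, Q, R}"
proof -
  define \<sigma> where "\<sigma> = s / \<nu>"
  have s: "s = \<sigma> * \<nu>" and \<sigma>: "0 \<le> \<sigma>"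
    using pos coeff by (simp_all add: \<sigma>_def)
  have "s *\<^sub>R S = \<sigma> *\<^sub>R (\<alpha> *\<^sub>R P + \<rho> *\<^sub>R R - \<mu> *\<^sub>R Q)"
    unfolding cross(1) by (simp add: s)
  then have "p *\<^sub>R P + q *\<^sub>R Q + r *\<^sub>R R + s *\<^sub>R S
      = (p + \<sigma> * \<alpha>) *\<^sub>R P + (q - \<sigma> * \<mu>) *\<^sub>R Q + (r + \<sigma> * \<rho>) *\<^sub>R R"
    by (simp add: algebra_simps)
  moreover have "0 \<le> q - \<sigma> * \<mu>"
    using coeff(5) pos by (simp add: \<sigma>_def field_simps)
  moreover have "(p + \<sigma> * \<alpha>) + (q - \<sigma> * \<mu>) + (r + \<sigma> * \<rho>) = 1"
  proof -
    have "\<sigma> * (\<alpha> + \<rho>) = \<sigma> * \<mu> + s"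
      unfolding cross(2) s by (simp add: algebra_simps)
    then show ?thesis using coeff(4) by (simp add: algebra_simps)
  qed
  ultimately show ?thesis
    unfolding convex_hull_3 using pos coeff(1,2) \<sigma> by fastforce
qed

lemma convex_hull_split_diagonal:
  fixes P Q R S :: "'a::real_vector"
  assumes cross: "\<alpha> *\<^sub>R P + \<rho> *\<^sub>R R = \<mu> *\<^sub>R Q + \<nu> *\<^sub>R S" "\<alpha> + \<rho> = \<mu> + \<nu>"
    and pos: "0 \<le> \<alpha>" "0 \<le> \<rho>" "0 < \<mu>" "0 < \<nu>"
  shows "convex hull {P, Q, R, S} = convex hull {P, Q, R} \<union> convex hull {P, R, S}"
proof
  show "convex hull {P, Q, R} \<union> convex hull {P, R, S} \<subseteq> convex hull {P, Q, R, S}"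
    by (intro Un_least hull_mono) auto
  show "convex hull {P, Q, R, S} \<subseteq> convex hull {P, Q, R} \<union> convex hull {P, R, S}"
  proof
    fix x assume "x \<in> convex hull {P, Q, R, S}"
    also have "{P, Q, R, S} = insert S {P, Q, R}" by auto
    finally obtain t y where t: "0 \<le> t" "t \<le> 1" "y \<in> convex hull {P, Q, R}"
      "x = (1 - t) *\<^sub>R S + t *\<^sub>R y"
      unfolding convex_hull_insert_alt[of S "{P, Q, R}"] if_not_P[OF insert_not_empty]
      by blast
    then obtain p q r where pqr: "0 \<le> p" "0 \<le> q" "0 \<le> r" "p + q + r = 1"
      "y = p *\<^sub>R P + q *\<^sub>R Q + r *\<^sub>R R"
      unfolding convex_hull_3 by auto
    define p' q' r' s where "p' = t * p" "q' = t * q" "r' = t * r" "s = 1 - t"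
    note defs = this
    have nn: "0 \<le> p'" "0 \<le> q'" "0 \<le> r'" "0 \<le> s"
      using t pqr by (simp_all add: defs)
    have "p' + q' + r' = t"
      using pqr(4) unfolding defs by (metis distrib_left mult.right_neutral)
    then have sum: "p' + q' + r' + s = 1"
      by (simp add: defs)
    have x: "x = p' *\<^sub>R P + q' *\<^sub>R Q + r' *\<^sub>R R + s *\<^sub>R S"
      by (simp add: t pqr defs algebra_simps)
    show "x \<in> convex hull {P, Q, R} \<union> convex hull {P, R, S}"
    proof (cases "s * \<mu> \<le> q' * \<nu>")
      case True
      then have "x \<in> convex hull {P, Q, R}"
        unfolding x using eliminate_vertex[OF cross pos(1,2,4) nn(1,3,4) sum] by simp
      then show ?thesis ..
    next
      case False
      have "\<alpha> *\<^sub>R P + \<rho> *\<^sub>R R = \<nu> *\<^sub>R S + \<mu> *\<^sub>R Q" "\<alpha> + \<rho> = \<nu> + \<mu>"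
        using cross by (simp_all add: add.commute)
      from eliminate_vertex[OF this pos(1-3) nn(1,3,2), of s] False sum
      have "p' *\<^sub>R P + s *\<^sub>R S + r' *\<^sub>R R + q' *\<^sub>R Q \<in> convex hull {P, S, R}"
        by simp
      moreover have "p' *\<^sub>R P + s *\<^sub>R S + r' *\<^sub>R R + q' *\<^sub>R Q = x" "{P, S, R} = {P, R, S}"
        by (auto simp: x)
      ultimately show ?thesis by simp
    qed
  qed
qed

text \<open>Seen from the diagonal \<open>PR\<close>, the triangle lies on the side of its third vertex.  When \<open>Q\<close> and
  \<open>S\<close> are on different sides, the two triangles on the diagonal hence overlap only in a null set.\<close>
lemma orient_hull_diagonal:
  assumes "x \<in> convex hull {P, Q, R}"
  obtains v where "0 \<le> v" "orient P R x = v * orient P R Q"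
proof -
  obtain u v w where uvw: "0 \<le> v" "u + v + w = 1" "x = u *\<^sub>R P + v *\<^sub>R Q + w *\<^sub>R R"
    using assms by (auto simp: convex_hull_3)
  have u: "u = 1 - v - w" using uvw(2) by simp
  have "orient P R x = v * orient P R Q"
    unfolding uvw(3) u orient_def by (simp add: algebra_simps)
  with uvw(1) show ?thesis by (rule that)
qed

lemma negligible_line:
  assumes "P \<noteq> Q"
  shows "negligible {x. orient P Q x = 0}"
proof -
  define n :: "real^2" where "n = vector [- (Q$2 - P$2), Q$1 - P$1]"
  have "n \<noteq> 0"
    using assms by (auto simp: n_def vec_eq_iff forall_2)
  moreover have "{x. orient P Q x = 0} = {x. n \<bullet> x = n \<bullet> P}"
    by (auto simp: orient_def n_def inner_real2 algebra_simps)
  ultimately show ?thesis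
    by (simp add: negligible_hyperplane)
qed

text \<open>The four products of the characterisation link the orientations of all four
  corner triangles, so that these share one sign: the vertices are met in cyclic order.\<close>
lemma convex_quadrilateral_signs:
  assumes "convex_quadrilateral P Q R S"
  shows "0 < orient P Q R \<and> 0 < orient Q R S \<and> 0 < orient P R S \<and> 0 < orient P Q S \<or>
         orient P Q R < 0 \<and> orient Q R S < 0 \<and> orient P R S < 0 \<and> orient P Q S < 0"
proof -
  have "orient Q R P = orient P Q R" "orient R S P = orient P R S" "orient R S Q = orient Q R S"
     "orient S P Q = orient P Q S" "orient S P R = orient P R S"
    by (simp_all add: orient_def algebra_simps)
  then show ?thesis
    using assms by (auto simp: convex_quadrilateral_iff_orient zero_less_mult_iff)
qed

lemma quad_area_orient:
  assumes "convex_quadrilateral P Q R S"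
  shows "quad_area P Q R S = \<bar>orient P Q R + orient P R S\<bar> / 2"
proof -
  note signs = convex_quadrilateral_signs[OF assms]
  let ?T = "convex hull {P, Q, R}" and ?U = "convex hull {P, R, S}"
  have split: "convex hull {P, Q, R, S} = ?T \<union> ?U"
    using signs
  proof
    assume "0 < orient P Q R \<and> 0 < orient Q R S \<and> 0 < orient P R S \<and> 0 < orient P Q S"
    then show ?thesis
      by (intro convex_hull_split_diagonal[OF diagonals_cross]) auto
  next
    assume neg: "orient P Q R < 0 \<and> orient Q R S < 0 \<and> orient P R S < 0 \<and> orient P Q S < 0"
    have "(- orient Q R S) *\<^sub>R P + (- orient P Q S) *\<^sub>R R
        = (- orient P R S) *\<^sub>R Q + (- orient P Q R) *\<^sub>R S"
      "- orient Q R S + - orient P Q S = - orient P R S + - orient P Q R"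
      using diagonals_cross[of Q R S P] by (simp_all add: algebra_simps)
    from convex_hull_split_diagonal[OF this] neg show ?thesis by auto
  qed
  have "?T \<inter> ?U \<subseteq> {x. orient P R x = 0}"
  proof clarify
    fix x assume "x \<in> ?T" "x \<in> ?U"
    moreover have "{P, R, S} = {P, S, R}" by auto
    ultimately obtain v w where v: "0 \<le> v" "orient P R x = v * orient P R Q"
      and w: "0 \<le> w" "orient P R x = w * orient P R S"
      using orient_hull_diagonal[of x P Q R] orient_hull_diagonal[of x P S R] by metis
    have "orient P R Q = - orient P Q R"
      by (simp add: orient_def)
    with v w signs show "orient P R x = 0"
      by (smt (verit) mult_nonneg_nonneg mult_nonneg_nonpos)
  qed
  moreover have "P \<noteq> R"
    using assms by (simp add: convex_quadrilateral_def)
  ultimately have "negligible (?T \<inter> ?U)"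
    using negligible_line negligible_subset by blast
  then have "measure lebesgue (?T \<inter> ?U) = 0"
    by (rule negligible_imp_measure0)
  moreover have "?T \<in> lmeasurable" "?U \<in> lmeasurable"
    by (simp_all add: lmeasurable_compact finite_imp_compact_convex_hull)
  ultimately have "measure lebesgue (?T \<union> ?U) = measure lebesgue ?T + measure lebesgue ?U"
    by (simp add: measure_Un3)
  then show ?thesis
    using signs by (auto simp: quad_area_def split measure_triangle field_simps)
qed

section \<open>Similarities\<close>

text \<open>No determinant of \<open>g\<close> appears: each orientation is multiplied by \<open>\<plusminus>k\<^sup>2\<close>, with the same
  sign in both factors.\<close>
lemma orient_product_similarity:
  fixes g :: "real^2 \<Rightarrow> real^2" and k :: real and w :: "real^2"
  assumes "orthogonal_transformation g"
  defines "T \<equiv> \<lambda>x. w + k *\<^sub>R g x"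
  shows "orient (T P) (T Q) (T R) * orient (T P') (T Q') (T R')
       = k^4 * (orient P Q R * orient P' Q' R')"
proof -
  have "T x - T y = k *\<^sub>R g (x - y)" for x y
    using assms(1) by (simp add: T_def orthogonal_transformation_def linear_diff scaleR_diff_right)
  then have "(T x - T y) \<bullet> (T x' - T y') = k\<^sup>2 * ((x - y) \<bullet> (x' - y'))" for x y x' y'
    using assms(1) by (simp add: orthogonal_transformation_def power2_eq_square)
  note inner = this
  show ?thesis
    unfolding orient_product inner
    by (simp add: power4_eq_xxxx power2_eq_square right_diff_distrib mult_ac)
qed

lemma convex_quadrilateral_similarity:
  fixes g :: "real^2 \<Rightarrow> real^2"
  assumes "orthogonal_transformation g" "k \<noteq> 0"
  shows "convex_quadrilateral (w + k *\<^sub>R g P) (w + k *\<^sub>R g Q) (w + k *\<^sub>R g R) (w + k *\<^sub>R g S)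
     \<longleftrightarrow> convex_quadrilateral P Q R S"
  using assms(2)
  by (simp add: convex_quadrilateral_iff_orient orient_product_similarity[OF assms(1)]
      zero_less_mult_iff)

lemma quad_area_similarity:
  fixes g :: "real^2 \<Rightarrow> real^2"
  assumes g: "orthogonal_transformation g" and "k \<noteq> 0" and cv: "convex_quadrilateral P Q R S"
  shows "quad_area (w + k *\<^sub>R g P) (w + k *\<^sub>R g Q) (w + k *\<^sub>R g R) (w + k *\<^sub>R g S)
     = k\<^sup>2 * quad_area P Q R S"
proof -
  let ?T = "\<lambda>x. w + k *\<^sub>R g x"
  \<comment> \<open>Squaring leaves only products of two orientations, whose behaviour under similarities is known.\<close>
  have "(orient (?T P) (?T Q) (?T R) + orient (?T P) (?T R) (?T S))\<^sup>2
      = k^4 * (orient P Q R + orient P R S)\<^sup>2"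
    using orient_product_similarity[OF g, of w k]
    by (simp add: power2_eq_square distrib_left distrib_right)
  also have "\<dots> = (k\<^sup>2 * (orient P Q R + orient P R S))\<^sup>2"
    by (simp add: power_mult_distrib)
  finally have "\<bar>orient (?T P) (?T Q) (?T R) + orient (?T P) (?T R) (?T S)\<bar>
      = \<bar>k\<^sup>2 * (orient P Q R + orient P R S)\<bar>"
    by (auto simp: power2_eq_iff)
  then show ?thesis
    using cv by (simp add: quad_area_orient convex_quadrilateral_similarity[OF g \<open>k \<noteq> 0\<close>] abs_mult)
qed

section \<open>The quadrilateral given by the formulae\<close>

text \<open>The parametrisation of right triangles by the cotangent \<open>u / v\<close> of half an angle.\<close>
lemma half_angle_pythagoras:
  "(c * (u - v) * (u + v))\<^sup>2 + (2 * u * v * c)\<^sup>2 = (c * (u\<^sup>2 + v\<^sup>2))\<^sup>2"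
  for c u v :: "'a::comm_ring_1"
  by (simp add: power2_eq_square algebra_simps)

lemma len_e_minus_x1:
  "len_e t - x1 t = p1 t * p2 t * ((r1 t * s2 t + r2 t * s1 t) * (r1 t * s1 t - r2 t * s2 t))
     * (q1 t - q2 t) * (q1 t + q2 t)"
proof -
  have "(p * q' + p' * q) * (p * q - p' * q') * k * l - q * q' * k * l * (p - p') * (p + p')
      = p * p' * (k * l) * (q - q') * (q + q')" for p p' q q' k l :: rat
    by (simp add: algebra_simps)
  then show ?thesis unfolding len_e_def x1_def .
qed

lemma len_e_minus_x2:
  "len_e t - x2 t = r1 t * r2 t * ((p1 t * q2 t + p2 t * q1 t) * (p1 t * q1 t - p2 t * q2 t))
     * (s1 t - s2 t) * (s1 t + s2 t)"
proof -
  have "k * l * (r * s' + r' * s) * (r * s - r' * s') - s * s' * k * l * (r - r') * (r + r')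
      = r * r' * (k * l) * (s - s') * (s + s')" for r r' s s' k l :: rat
    by (simp add: algebra_simps)
  then show ?thesis unfolding len_e_def x2_def .
qed

text \<open>Each of the four sides is the hypotenuse of a right triangle whose legs are parallel to the
  axes, and each of these is a scaled instance of the half-angle parametrisation.\<close>
lemma coordinates_lengths:
  "(x1 t)\<^sup>2 + (y1 t)\<^sup>2 = (len_a t)\<^sup>2"
  "(len_e t - x1 t)\<^sup>2 + (y1 t)\<^sup>2 = (len_b t)\<^sup>2"
  "(len_e t - x2 t)\<^sup>2 + (y2 t)\<^sup>2 = (len_c t)\<^sup>2"
  "(x2 t)\<^sup>2 + (y2 t)\<^sup>2 = (len_d t)\<^sup>2"
proof -
  let ?M = "(p1 t * q2 t + p2 t * q1 t) * (p1 t * q1 t - p2 t * q2 t)"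
  let ?K = "(r1 t * s2 t + r2 t * s1 t) * (r1 t * s1 t - r2 t * s2 t)"
  have y1: "y1 t = 2 * p1 t * p2 t * (q1 t * q2 t * ?K)" "y1 t = 2 * q1 t * q2 t * (p1 t * p2 t * ?K)"
    by (simp_all only: y1_def mult_ac)
  have "(y2 t)\<^sup>2 = (- y2 t)\<^sup>2" by simp
  moreover have "- y2 t = 2 * r1 t * r2 t * (s1 t * s2 t * ?M)"
    "- y2 t = 2 * s1 t * s2 t * (r1 t * r2 t * ?M)"
    by (simp_all only: y2_def mult_ac mult_minus_left minus_minus)
  ultimately have y2: "(y2 t)\<^sup>2 = (2 * r1 t * r2 t * (s1 t * s2 t * ?M))\<^sup>2"
    "(y2 t)\<^sup>2 = (2 * s1 t * s2 t * (r1 t * r2 t * ?M))\<^sup>2"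
    by metis+
  have x: "x1 t = q1 t * q2 t * ?K * (p1 t - p2 t) * (p1 t + p2 t)"
    "x2 t = s1 t * s2 t * ?M * (r1 t - r2 t) * (r1 t + r2 t)"
    by (simp_all only: x1_def x2_def mult_ac)
  have len: "len_a t = q1 t * q2 t * ?K * ((p1 t)\<^sup>2 + (p2 t)\<^sup>2)"
    "len_b t = p1 t * p2 t * ?K * ((q1 t)\<^sup>2 + (q2 t)\<^sup>2)"
    "len_c t = r1 t * r2 t * ?M * ((s1 t)\<^sup>2 + (s2 t)\<^sup>2)"
    "len_d t = s1 t * s2 t * ?M * ((r1 t)\<^sup>2 + (r2 t)\<^sup>2)"
    by (simp_all only: len_a_def len_b_def len_c_def len_d_def mult_ac)
  show "(x1 t)\<^sup>2 + (y1 t)\<^sup>2 = (len_a t)\<^sup>2"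
    unfolding x y1(1) len by (rule half_angle_pythagoras)
  show "(len_e t - x1 t)\<^sup>2 + (y1 t)\<^sup>2 = (len_b t)\<^sup>2"
    unfolding len_e_minus_x1 y1(2) len by (rule half_angle_pythagoras)
  show "(len_e t - x2 t)\<^sup>2 + (y2 t)\<^sup>2 = (len_c t)\<^sup>2"
    unfolding len_e_minus_x2 y2(2) len by (rule half_angle_pythagoras)
  show "(x2 t)\<^sup>2 + (y2 t)\<^sup>2 = (len_d t)\<^sup>2"
    unfolding x y2(1) len by (rule half_angle_pythagoras)
qed

text \<open>The bracket of the area formula is half of \<open>y1 - y2\<close>, with the factor belonging to the angles
  at \<open>O\<close> and \<open>B\<close> above the diagonal expanded and that of the angles below it kept as a product.\<close>
lemma area_formula_eq: "2 * area_formula t = len_e t * (y1 t - y2 t)"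
proof -
  have "2 * (m * n * k * l * (p\<^sup>2 * q * q' * r * r' * s * s'
        + (q\<^sup>2 * r * r' * s * s' + k * l * q * q' - q'\<^sup>2 * r * r' * s * s') * p * p'
        - p'\<^sup>2 * q * q' * r * r' * s * s'))
     = m * n * k * l * (2 * p * p' * q * q' * k * l - - 2 * r * r' * s * s' * m * n)"
    if "m = p * q' + p' * q" "n = p * q - p' * q'" for p p' q q' r r' s s' k l m n :: rat
  proof -
    have mn: "m * n = p\<^sup>2 * q * q' + (q\<^sup>2 - q'\<^sup>2) * p * p' - p'\<^sup>2 * q * q'"
      unfolding that by (simp add: power2_eq_square algebra_simps)
    have "2 * p * p' * q * q' * k * l - - 2 * r * r' * s * s' * m * n
        = 2 * (p * p' * q * q' * k * l + r * r' * s * s' * (m * n))"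
      by (simp add: algebra_simps)
    also have "p * p' * q * q' * k * l + r * r' * s * s' * (m * n)
        = p\<^sup>2 * q * q' * r * r' * s * s'
        + (q\<^sup>2 * r * r' * s * s' + k * l * q * q' - q'\<^sup>2 * r * r' * s * s') * p * p'
        - p'\<^sup>2 * q * q' * r * r' * s * s'"
      unfolding mn by (simp add: algebra_simps)
    finally show ?thesis by simp
  qed
  from this[OF refl refl] show ?thesis
    unfolding area_formula_def len_e_def y1_def y2_def .
qed

lemma dist_real2: "dist u v = sqrt ((u$1 - v$1)\<^sup>2 + (u$2 - v$2)\<^sup>2)" for u v :: "real^2"
  by (simp add: dist_vec_def L2_set_def sum_2 dist_real_def)

lemma sqrt_of_rat_square:
  assumes "x\<^sup>2 + y\<^sup>2 = z\<^sup>2"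
  shows "sqrt ((of_rat x)\<^sup>2 + (of_rat y)\<^sup>2) = of_rat \<bar>z\<bar>"
proof -
  have "(of_rat x)\<^sup>2 + (of_rat y)\<^sup>2 = (of_rat z :: real)\<^sup>2"
    using arg_cong[OF assms, of "of_rat :: rat \<Rightarrow> real"] by (simp add: of_rat_add of_rat_power)
  then show ?thesis by (simp add: abs_of_rat)
qed

lemma dist_vertices:
  "dist (vertex_O t) (vertex_A t) = of_rat \<bar>len_a t\<bar>"
  "dist (vertex_A t) (vertex_B t) = of_rat \<bar>len_b t\<bar>"
  "dist (vertex_B t) (vertex_C t) = of_rat \<bar>len_c t\<bar>"
  "dist (vertex_C t) (vertex_O t) = of_rat \<bar>len_d t\<bar>"
  "dist (vertex_O t) (vertex_B t) = of_rat \<bar>len_e t\<bar>"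
  "dist (vertex_A t) (vertex_C t) = len_f t"
  using sqrt_of_rat_square[OF coordinates_lengths(1), of t] sqrt_of_rat_square[OF coordinates_lengths(2), of t]
    sqrt_of_rat_square[OF coordinates_lengths(3), of t] sqrt_of_rat_square[OF coordinates_lengths(4), of t]
  by (simp_all add: dist_real2 vertex_O_def vertex_A_def vertex_B_def vertex_C_def len_f_def
      of_rat_diff of_rat_add of_rat_power abs_of_rat power2_commute[of "of_rat (x1 t)"])

lemma orient_vertices:
  "orient (vertex_O t) (vertex_A t) (vertex_B t) = of_rat (- (len_e t * y1 t))"
  "orient (vertex_O t) (vertex_B t) (vertex_C t) = of_rat (len_e t * y2 t)"
  "orient (vertex_O t) (vertex_A t) (vertex_C t) = of_rat (x1 t * y2 t - x2 t * y1 t)"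
  "orient (vertex_A t) (vertex_B t) (vertex_C t)
     = of_rat (- (len_e t * y1 t - len_e t * y2 t + x1 t * y2 t - x2 t * y1 t))"
  by (simp_all add: orient_def vertex_O_def vertex_A_def vertex_B_def vertex_C_def
      of_rat_diff of_rat_add of_rat_mult of_rat_minus algebra_simps)

text \<open>The three inequalities say that \<open>A\<close> and \<open>C\<close> lie on different sides of the axis \<open>OB\<close> and that
  the line \<open>AC\<close> meets this axis strictly between \<open>O\<close> and \<open>B\<close>.  Writing
  \<open>D\<close> for \<open>x1 * y2 - x2 * y1\<close>, the orientations of the four corners are \<open>- e * y1\<close>, \<open>e * y2\<close>,
  \<open>D\<close> and the negative of the last factor, so both sides are the same condition on signs.\<close>
lemma convex_vertices_iff:
  assumes "0 < len_e t"
  shows "convex_quadrilateral (vertex_O t) (vertex_A t) (vertex_B t) (vertex_C t) \<longleftrightarrow>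
     0 < - y1 t * y2 t \<and>
     0 < - (y1 t - y2 t) * (x1 t * y2 t - x2 t * y1 t) \<and>
     0 < (y1 t - y2 t) * (len_e t * y1 t - len_e t * y2 t + x1 t * y2 t - x2 t * y1 t)"
proof -
  define D where "D = x1 t * y2 t - x2 t * y1 t"
  define E where "E = len_e t * y1 t - len_e t * y2 t + x1 t * y2 t - x2 t * y1 t"
  have same_sign: "0 < orient P Q R * orient P' Q' R' \<longleftrightarrow>
      0 < orient P Q R \<and> 0 < orient P' Q' R' \<or> orient P Q R < 0 \<and> orient P' Q' R' < 0"
    for P Q R P' Q' R' by (auto simp: zero_less_mult_iff)
  have "convex_quadrilateral (vertex_O t) (vertex_A t) (vertex_B t) (vertex_C t) \<longleftrightarrow>
      y1 t < 0 \<and> 0 < y2 t \<and> 0 < D \<and> E < 0 \<or> 0 < y1 t \<and> y2 t < 0 \<and> D < 0 \<and> 0 < E"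
    (is "_ \<longleftrightarrow> ?signs")
  proof -
    let ?O = "vertex_O t" and ?A = "vertex_A t" and ?B = "vertex_B t" and ?C = "vertex_C t"
    have "orient ?A ?B ?O = orient ?O ?A ?B" "orient ?B ?C ?O = orient ?O ?B ?C"
      "orient ?B ?C ?A = orient ?A ?B ?C" "orient ?C ?O ?A = orient ?O ?A ?C"
      "orient ?C ?O ?B = orient ?O ?B ?C"
      by (simp_all add: orient_def algebra_simps)
    then show ?thesis
      using assms
      unfolding convex_quadrilateral_iff_orient same_sign orient_vertices zero_less_of_rat_iff
        of_rat_less_0_iff D_def[symmetric] E_def[symmetric]
      by (auto simp: zero_less_mult_iff mult_less_0_iff)
  qed
  also have "\<dots> \<longleftrightarrow> 0 < - y1 t * y2 t \<and> 0 < - (y1 t - y2 t) * D \<and> 0 < (y1 t - y2 t) * E"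
    by (auto simp: zero_less_mult_iff mult_less_0_iff)
  finally show ?thesis
    unfolding D_def E_def .
qed

lemma admissible_iff_convex:
  "admissible t \<longleftrightarrow>
     convex_quadrilateral (vertex_O t) (vertex_A t) (vertex_B t) (vertex_C t) \<and>
     0 < len_a t \<and> 0 < len_b t \<and> 0 < len_c t \<and> 0 < len_d t \<and> 0 < len_e t"
  (is "_ \<longleftrightarrow> ?cv \<and> _")
proof -
  have "0 < len_f t" if ?cv
    using that by (simp flip: dist_vertices(6) add: convex_quadrilateral_def)
  then show ?thesis
    using convex_vertices_iff[of t] unfolding admissible_def by blast
qed

text \<open>The lengths of the sides and of \<open>OB\<close> always equal the absolute values of their formulae, and in a
  convex quadrilateral they do not vanish; so the equations force positive lengths.\<close>
lemma admissible_iff_lengths: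
  "admissible t \<longleftrightarrow>
     convex_quadrilateral (vertex_O t) (vertex_A t) (vertex_B t) (vertex_C t) \<and>
     dist (vertex_O t) (vertex_A t) = of_rat (len_a t) \<and>
     dist (vertex_A t) (vertex_B t) = of_rat (len_b t) \<and>
     dist (vertex_B t) (vertex_C t) = of_rat (len_c t) \<and>
     dist (vertex_C t) (vertex_O t) = of_rat (len_d t) \<and>
     dist (vertex_O t) (vertex_B t) = of_rat (len_e t) \<and>
     dist (vertex_A t) (vertex_C t) = len_f t"
  (is "_ \<longleftrightarrow> ?cv \<and> ?rest")
proof (cases ?cv)
  case True
  let ?O = "vertex_O t" and ?A = "vertex_A t" and ?B = "vertex_B t" and ?C = "vertex_C t"
  have "dist ?O ?A \<noteq> 0" "dist ?A ?B \<noteq> 0" "dist ?B ?C \<noteq> 0" "dist ?C ?O \<noteq> 0" "dist ?O ?B \<noteq> 0"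
    using True by (auto simp: convex_quadrilateral_def)
  then have "len_a t \<noteq> 0" "len_b t \<noteq> 0" "len_c t \<noteq> 0" "len_d t \<noteq> 0" "len_e t \<noteq> 0"
    by (auto simp: dist_vertices)
  then show ?thesis
    using True by (simp add: admissible_iff_convex dist_vertices) linarith
qed (simp add: admissible_iff_convex)

lemma area_vertices:
  assumes "admissible t"
  shows "quad_area (vertex_O t) (vertex_A t) (vertex_B t) (vertex_C t)
     = of_rat (if 0 < y1 t then area_formula t else - area_formula t)"
proof -
  have cv: "convex_quadrilateral (vertex_O t) (vertex_A t) (vertex_B t) (vertex_C t)"
    and e: "0 < len_e t" and y: "0 < - y1 t * y2 t"
    using assms by (auto simp: admissible_iff_convex convex_vertices_iff)
  have "quad_area (vertex_O t) (vertex_A t) (vertex_B t) (vertex_C t)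
      = \<bar>of_rat (- (2 * area_formula t))\<bar> / 2"
    unfolding quad_area_orient[OF cv] orient_vertices of_rat_add[symmetric] area_formula_eq
    by (simp add: algebra_simps)
  also have "\<dots> = of_rat \<bar>area_formula t\<bar>"
    by (simp add: of_rat_minus of_rat_mult abs_mult abs_of_rat)
  also have "\<bar>area_formula t\<bar> = (if 0 < y1 t then area_formula t else - area_formula t)"
  proof (cases "0 < y1 t")
    case True
    then have "0 < len_e t * (y1 t - y2 t)"
      using e y by (auto intro!: mult_pos_pos simp: mult_less_0_iff)
    then show ?thesis using True by (simp flip: area_formula_eq)
  next
    case False
    then have "len_e t * (y1 t - y2 t) < 0"
      using e y by (auto intro!: mult_pos_neg simp: mult_less_0_iff)
    then show ?thesis using False by (simp flip: area_formula_eq)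
  qed
  finally show ?thesis .
qed

section \<open>Recovering the parameters\<close>

text \<open>For a triangle with base \<open>e\<close> on the axis, apex \<open>(X, Y)\<close> and sides \<open>a\<close>, \<open>b\<close>, the half-angle
  cotangents at the two ends of the base are \<open>(a + X) / Y\<close> and \<open>(b + e - X) / Y\<close>.  Taking their
  numerators and denominators as the parameters reproduces the triangle, magnified by \<open>N\<close>.\<close>
lemma half_angle_triangle:
  fixes a b e X Y :: "'a::comm_ring_1"
  assumes "X\<^sup>2 + Y\<^sup>2 = a\<^sup>2" "(e - X)\<^sup>2 + Y\<^sup>2 = b\<^sup>2"
  defines "p \<equiv> a + X" and "q \<equiv> b + e - X"
  defines "N \<equiv> 2 * p * q * Y"
  shows "q * Y * (p\<^sup>2 + Y\<^sup>2) = a * N"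
    and "p * Y * (q\<^sup>2 + Y\<^sup>2) = b * N"
    and "q * Y * ((p - Y) * (p + Y)) = X * N"
    and "2 * p * Y * q * Y = Y * N"
    and "(p * Y + Y * q) * (p * q - Y * Y) = e * N"
proof -
  have Y: "Y\<^sup>2 = a\<^sup>2 - X\<^sup>2" "Y\<^sup>2 = b\<^sup>2 - (e - X)\<^sup>2"
    by (simp_all flip: assms(1,2))
  have p: "p\<^sup>2 + Y\<^sup>2 = 2 * a * p" "p\<^sup>2 - Y\<^sup>2 = 2 * X * p"
    unfolding Y(1) p_def by (simp_all add: power2_eq_square algebra_simps)
  have q: "q\<^sup>2 + Y\<^sup>2 = 2 * b * q" "q\<^sup>2 - Y\<^sup>2 = 2 * (e - X) * q"
    unfolding Y(2) q_def by (simp_all add: power2_eq_square algebra_simps)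
  show "q * Y * (p\<^sup>2 + Y\<^sup>2) = a * N" "p * Y * (q\<^sup>2 + Y\<^sup>2) = b * N" "2 * p * Y * q * Y = Y * N"
    unfolding p q N_def by (simp_all only: mult_ac)
  have diff: "(p - Y) * (p + Y) = p\<^sup>2 - Y\<^sup>2"
    by (simp add: power2_eq_square algebra_simps)
  show "q * Y * ((p - Y) * (p + Y)) = X * N"
    unfolding diff p N_def by (simp only: mult_ac)
  have "(p * Y + Y * q) * (p * q - Y * Y) = q * Y * (p\<^sup>2 - Y\<^sup>2) + p * Y * (q\<^sup>2 - Y\<^sup>2)"
    by (simp add: power2_eq_square algebra_simps)
  also have "\<dots> = X * N + (e - X) * N"
    unfolding p q N_def by (simp only: mult_ac)
  finally show "(p * Y + Y * q) * (p * q - Y * Y) = e * N"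
    by (simp add: algebra_simps)
qed

lemma abs_less_hypotenuse:
  fixes x y z :: "'a::linordered_idom"
  assumes "x\<^sup>2 + y\<^sup>2 = z\<^sup>2" "0 < z" "y \<noteq> 0"
  shows "\<bar>x\<bar> < z"
proof -
  have "0 < y\<^sup>2" using assms(3) by simp
  then have "\<bar>x\<bar>\<^sup>2 < z\<^sup>2" by (simp flip: assms(1))
  then show ?thesis
    by (rule power2_less_imp_less) (use assms(2) in simp)
qed

text \<open>The formulae scale each triangle by the base of the other one, so that the two share the
  diagonal.  The common magnification is \<open>e * M * K\<close>, where \<open>M\<close> and \<open>K\<close> magnify the upper and the lower
  triangle.  The lower triangle is used in its mirror image, with height \<open>- W\<close>; then \<open>M\<close> and \<open>K\<close> have
  the same sign, also when \<open>A\<close> lies below the diagonal.\<close>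
lemma parameters_exist:
  fixes a b c d e X Y Z W :: rat
  assumes tri: "X\<^sup>2 + Y\<^sup>2 = a\<^sup>2" "(e - X)\<^sup>2 + Y\<^sup>2 = b\<^sup>2" "(e - Z)\<^sup>2 + W\<^sup>2 = c\<^sup>2" "Z\<^sup>2 + W\<^sup>2 = d\<^sup>2"
    and pos: "0 < a" "0 < b" "0 < c" "0 < d" "0 < e" and opp: "Y * W < 0"
  obtains t k where "0 < k" "k * len_a t = a" "k * len_b t = b" "k * len_c t = c"
    "k * len_d t = d" "k * len_e t = e" "k * x1 t = X" "k * y1 t = Y" "k * x2 t = Z" "k * y2 t = W"
proof -
  have YW: "Y \<noteq> 0" "W \<noteq> 0" using opp by auto
  define p q r s where "p = a + X" "q = b + e - X" "r = d + Z" "s = c + e - Z"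
  note defs = this
  have pqrs: "0 < p" "0 < q" "0 < r" "0 < s"
    using abs_less_hypotenuse[OF tri(1)] abs_less_hypotenuse[OF tri(2)]
      abs_less_hypotenuse[OF tri(3)] abs_less_hypotenuse[OF tri(4)] pos YW
    unfolding defs abs_less_iff by linarith+
  define t where "t = \<lparr>p1 = p, p2 = Y, q1 = q, q2 = Y, r1 = r, r2 = - W, s1 = s, s2 = - W\<rparr>"
  define M K where "M = 2 * p * q * Y" "K = 2 * r * s * (- W)"
  have lo_eqs: "Z\<^sup>2 + (- W)\<^sup>2 = d\<^sup>2" "(e - Z)\<^sup>2 + (- W)\<^sup>2 = c\<^sup>2"
    using tri by simp_all
  note up = half_angle_triangle[OF tri(1,2), folded defs, folded M_K_def]
    and lo = half_angle_triangle[OF lo_eqs, folded defs, folded M_K_def]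
  have MK: "0 < M * K"
  proof -
    have "M * K = (4 * p * q * r * s) * (- (Y * W))" by (simp add: M_K_def)
    also have "\<dots> > 0" using pqrs opp by (intro mult_pos_pos) auto
    finally show ?thesis .
  qed
  define k where "k = 1 / (e * (M * K))"
  have M: "(p1 t * q2 t + p2 t * q1 t) * (p1 t * q1 t - p2 t * q2 t) = e * M"
    using up(5) by (simp only: t_def params.simps)
  have K: "(r1 t * s2 t + r2 t * s1 t) * (r1 t * s1 t - r2 t * s2 t) = e * K"
    using lo(5) by (simp only: t_def params.simps)
  have "len_a t = q * Y * (p\<^sup>2 + Y\<^sup>2) * (e * K)" "len_b t = p * Y * (q\<^sup>2 + Y\<^sup>2) * (e * K)"
    "x1 t = q * Y * ((p - Y) * (p + Y)) * (e * K)" "y1 t = 2 * p * Y * q * Y * (e * K)"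
    unfolding K[symmetric] by (simp_all only: len_a_def len_b_def x1_def y1_def t_def params.simps mult_ac)
  then have 1: "len_a t = a * (e * (M * K))" "len_b t = b * (e * (M * K))"
    "x1 t = X * (e * (M * K))" "y1 t = Y * (e * (M * K))"
    unfolding up by (simp_all only: mult_ac)
  have "len_d t = s * (- W) * (r\<^sup>2 + (- W)\<^sup>2) * (e * M)" "len_c t = r * (- W) * (s\<^sup>2 + (- W)\<^sup>2) * (e * M)"
    "x2 t = s * (- W) * ((r - - W) * (r + - W)) * (e * M)" "y2 t = - (2 * r * (- W) * s * (- W) * (e * M))"
    unfolding M[symmetric]
    by (simp_all only: len_c_def len_d_def x2_def y2_def t_def params.simps mult_ac
        mult_minus_left mult_minus_right)
  then have 2: "len_d t = d * (e * (M * K))" "len_c t = c * (e * (M * K))"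
    "x2 t = Z * (e * (M * K))" "y2 t = W * (e * (M * K))"
    unfolding lo by (simp_all only: mult_ac mult_minus_left mult_minus_right minus_minus)
  have "len_e t = ((p1 t * q2 t + p2 t * q1 t) * (p1 t * q1 t - p2 t * q2 t))
      * ((r1 t * s2 t + r2 t * s1 t) * (r1 t * s1 t - r2 t * s2 t))"
    by (simp only: len_e_def mult.assoc)
  then have 3: "len_e t = e * (e * (M * K))"
    unfolding M K by (simp only: mult_ac)
  have pos': "0 < e * (M * K)"
    using \<open>0 < e\<close> MK by (rule mult_pos_pos)
  then have nz: "e * (M * K) \<noteq> 0" by (metis less_irrefl)
  have k: "0 < k"
    unfolding k_def using zero_less_one pos' by (rule divide_pos_pos)
  have scale: "k * (z * (e * (M * K))) = z" for z
    unfolding k_def by (simp only: times_divide_eq_left mult_1 nonzero_mult_div_cancel_right[OF nz])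
  show ?thesis
    using k by (rule that[of k t]) (simp_all only: 1 2 3 scale)
qed

text \<open>A rational area gives only \<open>Y - W\<close>, the total height over the diagonal of signed heights \<open>Y\<close>, \<open>W\<close>
  on different sides.  The squares are rational by Pythagoras, and dividing their difference by \<open>Y - W\<close>
  yields \<open>Y + W\<close>.\<close>
lemma rational_heights:
  fixes Y W :: real
  assumes "Y\<^sup>2 \<in> \<rat>" "W\<^sup>2 \<in> \<rat>" "Y - W \<in> \<rat>" "Y \<noteq> W"
  shows "Y \<in> \<rat>" "W \<in> \<rat>"
proof -
  have "Y + W = (Y\<^sup>2 - W\<^sup>2) / (Y - W)"
    using assms(4) by (simp add: power2_eq_square field_simps)
  then have sum: "Y + W \<in> \<rat>"
    using assms by simp
  have "Y = ((Y + W) + (Y - W)) / 2" "W = ((Y + W) - (Y - W)) / 2"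
    by simp_all
  with sum assms(3) show "Y \<in> \<rat>" "W \<in> \<rat>"
    by (metis Rats_add Rats_diff Rats_divide Rats_number_of)+
qed

lemma diagonal_to_axis:
  fixes P R :: "real^2"
  assumes "P \<noteq> R"
  obtains g :: "real^2 \<Rightarrow> real^2"
    where "orthogonal_transformation g" "R = P + g (vector [dist P R, 0])"
proof -
  define u :: "real^2" where "u = vector [dist P R, 0]"
  have "norm u = dist P R"
    by (simp add: u_def norm_vec_def L2_set_def sum_2)
  then have "norm u = norm (R - P)"
    by (simp add: dist_norm norm_minus_commute)
  then obtain g :: "real^2 \<Rightarrow> real^2" where "orthogonal_transformation g" "g u = R - P"
    using orthogonal_transformation_exists by blast
  then show ?thesis
    by (intro that[of g]) (simp_all add: u_def)
qed

text \<open>Moving the diagonal to the axis makes all coordinates rational: the abscissae by the law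
  of cosines, the heights by the area.  The half-angle parameters then rebuild the quadrilateral.\<close>
lemma rational_quadrilateral_similar_to_formula:
  assumes cv: "convex_quadrilateral P Q R S"
    and rat: "dist P Q \<in> \<rat>" "dist Q R \<in> \<rat>" "dist R S \<in> \<rat>" "dist S P \<in> \<rat>" "dist P R \<in> \<rat>"
      "quad_area P Q R S \<in> \<rat>"
  obtains t g w and k :: rat where "admissible t" "0 < k" "orthogonal_transformation g"
    "P = w + of_rat k *\<^sub>R g (vertex_O t)" "Q = w + of_rat k *\<^sub>R g (vertex_A t)"
    "R = w + of_rat k *\<^sub>R g (vertex_B t)" "S = w + of_rat k *\<^sub>R g (vertex_C t)"
proof -
  have dist: "distinct [P, Q, R, S]"
    using cv by (simp add: convex_quadrilateral_def)
  obtain g :: "real^2 \<Rightarrow> real^2"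
    where g: "orthogonal_transformation g" and R: "R = P + g (vector [dist P R, 0])"
    using diagonal_to_axis[of P R] dist by auto
  obtain A C where A: "Q = P + g A" and C: "S = P + g C"
    using orthogonal_transformation_surj[OF g] by (metis surjD add_diff_cancel_left' diff_add_cancel)
  define B :: "real^2" where "B = vector [dist P R, 0]"
  have g0: "g 0 = 0"
    using g by (simp add: orthogonal_transformation_isometry)
  have iso: "dist (P + g x) (P + g y) = dist x y" for x y
    using g by (simp add: orthogonal_transformation_isometry)
  have P0: "P = P + g 0" by (simp add: g0)
  have B: "B$1 = dist P R" "B$2 = 0" and R': "R = P + g B"
    using R by (simp_all add: B_def)
  have cv': "convex_quadrilateral 0 A B C"
    using cv convex_quadrilateral_similarity[OF g, of 1 P 0 A B C] A C R' by (simp add: g0)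
  have area: "quad_area P Q R S = quad_area 0 A B C"
    using quad_area_similarity[OF g _ cv', of 1 P] A C R' by (simp add: g0)
  have sides: "dist P Q = dist 0 A" "dist Q R = dist A B" "dist R S = dist B C" "dist S P = dist C 0"
    using iso[of 0 A] iso[of A B] iso[of B C] iso[of C 0] by (simp_all add: A C R' g0)
  have e: "0 < B$1" using dist B by simp
  have orients: "orient 0 A B = - (B$1 * A$2)" "orient 0 B C = B$1 * C$2"
    by (simp_all add: orient_def B)
  have "(0 < orient 0 A B \<and> 0 < orient 0 B C) \<or> (orient 0 A B < 0 \<and> orient 0 B C < 0)"
    using convex_quadrilateral_signs[OF cv'] by auto
  then have opp: "A$2 * C$2 < 0"
    using e unfolding orients by (auto simp: zero_less_mult_iff mult_less_0_iff)
  have a: "(A$1)\<^sup>2 + (A$2)\<^sup>2 = (dist P Q)\<^sup>2" and b: "(B$1 - A$1)\<^sup>2 + (A$2)\<^sup>2 = (dist Q R)\<^sup>2"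
    and c: "(B$1 - C$1)\<^sup>2 + (C$2)\<^sup>2 = (dist R S)\<^sup>2" and d: "(C$1)\<^sup>2 + (C$2)\<^sup>2 = (dist S P)\<^sup>2"
    unfolding sides unfolding dist_real2 by (simp_all add: B(2) power2_commute)
  have "A$1 = ((dist P Q)\<^sup>2 + (B$1)\<^sup>2 - (dist Q R)\<^sup>2) / (2 * B$1)"
    "C$1 = ((dist S P)\<^sup>2 + (B$1)\<^sup>2 - (dist R S)\<^sup>2) / (2 * B$1)"
    using e unfolding a[symmetric] b[symmetric] c[symmetric] d[symmetric]
    by (simp_all add: power2_eq_square field_simps)
  moreover have eR: "B$1 \<in> \<rat>" using rat B by simp
  ultimately have XR: "A$1 \<in> \<rat>" "C$1 \<in> \<rat>"
    using rat by simp_all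
  have YR2: "(A$2)\<^sup>2 \<in> \<rat>" "(C$2)\<^sup>2 \<in> \<rat>"
  proof -
    have "(A$2)\<^sup>2 = (dist P Q)\<^sup>2 - (A$1)\<^sup>2" "(C$2)\<^sup>2 = (dist S P)\<^sup>2 - (C$1)\<^sup>2"
      using a d by linarith+
    then show "(A$2)\<^sup>2 \<in> \<rat>" "(C$2)\<^sup>2 \<in> \<rat>" using rat XR by simp_all
  qed
  have "quad_area 0 A B C = \<bar>B$1 * (C$2 - A$2)\<bar> / 2"
    by (simp add: quad_area_orient[OF cv'] orients algebra_simps)
  then have "\<bar>A$2 - C$2\<bar> = 2 * quad_area P Q R S / B$1"
    using e by (simp add: area abs_mult abs_minus_commute) (simp add: field_simps)
  then have "\<bar>A$2 - C$2\<bar> \<in> \<rat>"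
    using rat(6) eR by simp
  then have "A$2 - C$2 \<in> \<rat>"
    by (metis abs_if Rats_minus_iff)
  moreover have "A$2 \<noteq> C$2" using opp by (auto simp: mult_less_0_iff)
  ultimately have YR: "A$2 \<in> \<rat>" "C$2 \<in> \<rat>"
    using rational_heights[OF YR2] by blast+
  obtain a' b' c' d' e' X Y Z W where rats: "dist P Q = of_rat a'" "dist Q R = of_rat b'"
      "dist R S = of_rat c'" "dist S P = of_rat d'" "B$1 = of_rat e'" "A$1 = of_rat X"
      "A$2 = of_rat Y" "C$1 = of_rat Z" "C$2 = of_rat W"
    using rat(1-4) eR XR YR unfolding Rats_def by (elim imageE)
  have "X\<^sup>2 + Y\<^sup>2 = a'\<^sup>2" "(e' - X)\<^sup>2 + Y\<^sup>2 = b'\<^sup>2" "(e' - Z)\<^sup>2 + W\<^sup>2 = c'\<^sup>2" "Z\<^sup>2 + W\<^sup>2 = d'\<^sup>2"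
    using a b c d unfolding rats
    by (simp_all flip: of_rat_add of_rat_diff of_rat_power)
  moreover have pos: "0 < a'" "0 < b'" "0 < c'" "0 < d'" "0 < e'"
  proof -
    have "0 < real_of_rat a'" "0 < real_of_rat b'" "0 < real_of_rat c'" "0 < real_of_rat d'"
      "0 < real_of_rat e'"
      unfolding rats[symmetric] using dist e by auto
    then show "0 < a'" "0 < b'" "0 < c'" "0 < d'" "0 < e'"
      by (simp_all only: zero_less_of_rat_iff)
  qed
  moreover have "Y * W < 0"
    using opp unfolding rats by (simp flip: of_rat_mult)
  ultimately obtain t k where k: "0 < k" "k * len_a t = a'" "k * len_b t = b'" "k * len_c t = c'"
    "k * len_d t = d'" "k * len_e t = e'" "k * x1 t = X" "k * y1 t = Y" "k * x2 t = Z" "k * y2 t = W"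
    by (rule parameters_exist)
  have vertices: "0 = of_rat k *\<^sub>R vertex_O t" "A = of_rat k *\<^sub>R vertex_A t"
    "B = of_rat k *\<^sub>R vertex_B t" "C = of_rat k *\<^sub>R vertex_C t"
    by (simp_all add: vec_eq_iff forall_2 vertex_O_def vertex_A_def vertex_B_def vertex_C_def
        rats B(2) flip: k(6-10) of_rat_mult)
  have "orthogonal_transformation (\<lambda>x. x :: real^2)"
    by (simp add: orthogonal_transformation_def linear_id[unfolded id_def])
  then have "convex_quadrilateral (of_rat k *\<^sub>R vertex_O t) (of_rat k *\<^sub>R vertex_A t)
      (of_rat k *\<^sub>R vertex_B t) (of_rat k *\<^sub>R vertex_C t) \<longleftrightarrow>
    convex_quadrilateral (vertex_O t) (vertex_A t) (vertex_B t) (vertex_C t)"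
    using convex_quadrilateral_similarity[of "\<lambda>x. x" "of_rat k" 0] k(1) by simp
  then have "convex_quadrilateral (vertex_O t) (vertex_A t) (vertex_B t) (vertex_C t)"
    using cv' unfolding vertices[symmetric] by blast
  moreover have "0 < len_a t \<and> 0 < len_b t \<and> 0 < len_c t \<and> 0 < len_d t \<and> 0 < len_e t"
    using pos unfolding k(2-6)[symmetric] using k(1) by (simp add: zero_less_mult_iff)
  ultimately have "admissible t"
    by (simp add: admissible_iff_convex)
  moreover have "g (of_rat k *\<^sub>R x) = of_rat k *\<^sub>R g x" for x
    using g by (simp add: orthogonal_transformation_def linear_cmul)
  then have "P = P + of_rat k *\<^sub>R g (vertex_O t)" "Q = P + of_rat k *\<^sub>R g (vertex_A t)"
    "R = P + of_rat k *\<^sub>R g (vertex_B t)" "S = P + of_rat k *\<^sub>R g (vertex_C t)"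
    using P0 A R' C vertices by metis+
  ultimately show ?thesis
    using g k(1) by (intro that[of t k g P])
qed

lemma similar_to_formula_rational:
  fixes k :: rat and g :: "real^2 \<Rightarrow> real^2" and w :: "real^2" and t :: params
  assumes t: "admissible t" and "0 < k" and g: "orthogonal_transformation g"
  defines "T \<equiv> \<lambda>x. w + of_rat k *\<^sub>R g x"
  defines "P \<equiv> T (vertex_O t)" and "Q \<equiv> T (vertex_A t)"
    and "R \<equiv> T (vertex_B t)" and "S \<equiv> T (vertex_C t)"
  shows "convex_quadrilateral P Q R S" "quad_area P Q R S \<in> \<rat>"
    "dist P Q \<in> \<rat>" "dist Q R \<in> \<rat>" "dist R S \<in> \<rat>" "dist S P \<in> \<rat>" "dist P R \<in> \<rat>"
proof -
  have k: "of_rat k \<noteq> (0::real)" using \<open>0 < k\<close> by simp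
  have cv: "convex_quadrilateral (vertex_O t) (vertex_A t) (vertex_B t) (vertex_C t)"
    using t by (simp add: admissible_iff_convex)
  then show "convex_quadrilateral P Q R S"
    unfolding P_def Q_def R_def S_def T_def by (simp add: convex_quadrilateral_similarity[OF g k])
  show "quad_area P Q R S \<in> \<rat>"
    unfolding P_def Q_def R_def S_def T_def
    by (simp add: quad_area_similarity[OF g k cv] area_vertices[OF t])
  have "dist (T x) (T y) = of_rat k * dist x y" for x y
  proof -
    have "dist (T x) (T y) = of_rat k * dist (g x) (g y)"
      using \<open>0 < k\<close> by (simp add: T_def dist_norm flip: scaleR_diff_right)
    then show ?thesis
      using g by (simp add: orthogonal_transformation_isometry)
  qed
  then show "dist P Q \<in> \<rat>" "dist Q R \<in> \<rat>" "dist R S \<in> \<rat>" "dist S P \<in> \<rat>" "dist P R \<in> \<rat>"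
    unfolding P_def Q_def R_def S_def by (simp_all add: dist_vertices)
qed

theorem mainTheorem2:
  shows
    "(\<forall>t. admissible t \<longleftrightarrow>
       convex_quadrilateral (vertex_O t) (vertex_A t) (vertex_B t) (vertex_C t) \<and>
       dist (vertex_O t) (vertex_A t) = of_rat (len_a t) \<and>
       dist (vertex_A t) (vertex_B t) = of_rat (len_b t) \<and>
       dist (vertex_B t) (vertex_C t) = of_rat (len_c t) \<and>
       dist (vertex_C t) (vertex_O t) = of_rat (len_d t) \<and>
       dist (vertex_O t) (vertex_B t) = of_rat (len_e t) \<and>
       dist (vertex_A t) (vertex_C t) = len_f t)
     \<and>
     (\<forall>P Q R S :: real^2.
       (convex_quadrilateral P Q R S \<and>
        dist P Q \<in> \<rat> \<and> dist Q R \<in> \<rat> \<and> dist R S \<in> \<rat> \<and> dist S P \<in> \<rat> \<and>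
        dist P R \<in> \<rat> \<and> quad_area P Q R S \<in> \<rat>)
       \<longleftrightarrow>
       (\<exists>t (k :: rat) g w.
          admissible t \<and> 0 < k \<and> orthogonal_transformation g \<and>
          P = w + of_rat k *\<^sub>R g (vertex_O t) \<and>
          Q = w + of_rat k *\<^sub>R g (vertex_A t) \<and>
          R = w + of_rat k *\<^sub>R g (vertex_B t) \<and>
          S = w + of_rat k *\<^sub>R g (vertex_C t)))
     \<and>
     (\<forall>t. admissible t \<longrightarrow>
       quad_area (vertex_O t) (vertex_A t) (vertex_B t) (vertex_C t)
         = of_rat (if 0 < y1 t then area_formula t else - area_formula t))"
proof (intro conjI allI impI)
  fix P Q R S :: "real^2"
  show "(convex_quadrilateral P Q R S \<and>
        dist P Q \<in> \<rat> \<and> dist Q R \<in> \<rat> \<and> dist R S \<in> \<rat> \<and> dist S P \<in> \<rat> \<and>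
        dist P R \<in> \<rat> \<and> quad_area P Q R S \<in> \<rat>)
       \<longleftrightarrow>
       (\<exists>t (k :: rat) g w.
          admissible t \<and> 0 < k \<and> orthogonal_transformation g \<and>
          P = w + of_rat k *\<^sub>R g (vertex_O t) \<and>
          Q = w + of_rat k *\<^sub>R g (vertex_A t) \<and>
          R = w + of_rat k *\<^sub>R g (vertex_B t) \<and>
          S = w + of_rat k *\<^sub>R g (vertex_C t))" (is "?rational \<longleftrightarrow> ?similar")
  proof
    assume ?rational
    then show ?similar
      using rational_quadrilateral_similar_to_formula[of P Q R S ?similar] by blast
  next
    assume ?similar
    then obtain t g w and k :: rat where t: "admissible t" and k: "0 < k"
      and g: "orthogonal_transformation g"
      and eqs: "P = w + of_rat k *\<^sub>R g (vertex_O t)" "Q = w + of_rat k *\<^sub>R g (vertex_A t)"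
        "R = w + of_rat k *\<^sub>R g (vertex_B t)" "S = w + of_rat k *\<^sub>R g (vertex_C t)"
      by blast
    show ?rational
      unfolding eqs by (intro conjI similar_to_formula_rational[OF t k g])
  qed
qed (fact admissible_iff_lengths area_vertices)+

end
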